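(* (a) If $v=2m+1$, then $\mathrm{BHR}(L)$ holds for $L=(L^*\setminus\{m,m\})\cup\{z_1,z_2\}$ for any $1\leq z_1,z_2<m$; in particular such $L$ is the edge-length list of some Hamiltonian path of $K_v$. (b) If $v=2m$, then $\mathrm{BHR}(L)$ holds for $L=(L^*\setminus\{m-1,m-1\})\cup\{z_1,z_2\}$ for any $1\leq z_1,z_2<m-1$; in particular such $L$ is the edge-length list of some Hamiltonian path of $K_v$. (Here $\setminus$ removes the indicated copies and $\cup$ is multiset union.)
   Context: $K_v$ is the complete graph on vertex set $\{0,1,\ldots,v-1\}$; the length of an edge $[x,y]$ is $\min(|x-y|,v-|x-y|)$ and $\ell(H)$ is the multiset of edge lengths of $H$. If $v=2m+1$, $L^*=\{1^2,2^2,\ldots,m^2\}$; if $v=2m$, $L^*=\{1^2,2^2,\ldots,(m-1)^2,m^1\}$, where $i^{a}$ denotes $a$ copies of $i$. For a list $L$ of $v-1$ positive integers not exceeding $\lfloor v/2\rfloor$, $\mathrm{BHR}(L)$ is the statement: there exists a Hamiltonian path $H$ of $K_v$ with $\ell(H)=L$ if and only if for every divisor $d$ of $v$ the number of elements of $L$ (with multiplicity) that are multiples of $d$ is at most $v-d$. *)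

theory Defs
  imports Main "HOL-Library.Multiset"
begin

definition complete_graph_edges :: "nat \<Rightarrow> nat set set" where
  "complete_graph_edges v = {{x, y} | x y. x < v \<and> y < v \<and> x \<noteq> y}"

definition edge_length :: "nat \<Rightarrow> nat \<Rightarrow> nat \<Rightarrow> nat" where
  "edge_length v x y =
     min (nat \<bar>int x - int y\<bar>) (v - nat \<bar>int x - int y\<bar>)"

text \<open>A path is represented by the list of its vertices in order; its edges join consecutive
  entries.\<close>

definition hamiltonian_path :: "nat \<Rightarrow> nat list \<Rightarrow> bool" where
  "hamiltonian_path v H \<longleftrightarrow>
     distinct H \<and> set H = {0..<v} \<and>
     successively (\<lambda>x y. {x, y} \<in> complete_graph_edges v) H"

definition edge_lengths :: "nat \<Rightarrow> nat list \<Rightarrow> nat multiset" where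
  "edge_lengths v H = mset (map2 (edge_length v) (butlast H) (tl H))"

definition Lstar :: "nat \<Rightarrow> nat multiset" where
  "Lstar v =
     (if odd v then (\<Sum>i\<in>{1..v div 2}. replicate_mset 2 i)
      else (\<Sum>i\<in>{1..<v div 2}. replicate_mset 2 i) + {#v div 2#})"

text \<open>Intended for \<open>v \<ge> 1\<close> and multisets \<open>L\<close> of \<open>v - 1\<close> integers in \<open>{1..v div 2}\<close>. Every
  divisor \<open>d\<close> of \<open>v \<ge> 1\<close> is at most \<open>v\<close>, so the subtraction \<open>v - d\<close> does not truncate.\<close>

definition BHR :: "nat \<Rightarrow> nat multiset \<Rightarrow> bool" where
  "BHR v L \<longleftrightarrow>
     ((\<exists>H. hamiltonian_path v H \<and> edge_lengths v H = L) \<longleftrightarrow>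
      (\<forall>d. d dvd v \<longrightarrow> size (filter_mset (\<lambda>l. d dvd l) L) \<le> v - d))"

end

theory Submission
  imports Defs
begin

text \<open>
  Call a Hamiltonian path on \<open>{0..<n}\<close> graceful if its consecutive differences are
  \<open>1, \<dots>, n - 1\<close>, each once. For \<open>v = 2 m + 1\<close>, take a graceful path on the interval
  \<open>{0..<m}\<close> starting at \<open>z1 - 1\<close>, traverse it backwards, step to the vertex \<open>2 m\<close>, and
  continue with a mirrored graceful path on \<open>{m..<2 m}\<close> starting at \<open>2 m - z2\<close>: the two joining
  edges have lengths \<open>z1\<close> and \<open>z2\<close>. For \<open>v = 2 m\<close> the two graceful paths live on intervals
  of \<open>m - 1\<close> vertices and are joined through two antipodal vertices.

  So everything rests on the existence of a graceful path with a prescribed first vertex \<open>k\<close>.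
  A zigzag \<open>k, h, k - 1, h + 1, \<dots>\<close> that exhausts both ends of the interval consumes the largest
  differences and leaves the same problem, with the same \<open>k\<close>, on the remaining inner interval.
  This works for \<open>k\<close> small relative to \<open>n\<close>. If the path alternates between a low block
  \<open>{0..<p}\<close> and a high block \<open>{p..<n}\<close>, reversing both blocks replaces \<open>k\<close> by
  \<open>p - 1 - k\<close> and each difference \<open>d\<close> by \<open>n - d\<close>, which brings \<open>k\<close> into that range;
  in the self-symmetric case \<open>n = 2 p\<close>, \<open>p = 2 k + 1\<close> the inner path is itself a zigzag starting
  at its centre.
  The divisor condition is necessary because a path meeting all \<open>d\<close> residue classes modulo \<open>d\<close>
  has at least \<open>d - 1\<close> edges of length not divisible by \<open>d\<close>.
\<close>

section \<open>Differences along integer paths\<close>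

fun gaps :: "int list \<Rightarrow> int list" where
  "gaps [] = []"
| "gaps [x] = []"
| "gaps (x # y # zs) = \<bar>x - y\<bar> # gaps (y # zs)"

text \<open>Together with gracefulness this is an alpha-labelling of a path, the form that block
  reversal needs.\<close>

definition alternating :: "int \<Rightarrow> int list \<Rightarrow> bool" where
  "alternating p H \<longleftrightarrow> successively (\<lambda>x y. x < p \<longleftrightarrow> \<not> y < p) H"

text \<open>Multiset equations let concatenated pieces add up; equality with \<open>mset_set\<close>
  also rules out repetitions.\<close>

definition graceful :: "int \<Rightarrow> int list \<Rightarrow> bool" where
  "graceful n H \<longleftrightarrow> mset H = mset_set {0..<n} \<and> mset (gaps H) = mset_set {1..<n}"

fun zigzag :: "int \<Rightarrow> int \<Rightarrow> nat \<Rightarrow> int list" where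
  "zigzag a b 0 = []"
| "zigzag a b (Suc s) = a # b # zigzag (a - 1) (b + 1) s"

lemma gaps_append:
  "xs \<noteq> [] \<Longrightarrow> ys \<noteq> [] \<Longrightarrow> gaps (xs @ ys) = gaps xs @ \<bar>last xs - hd ys\<bar> # gaps ys"
proof (induction xs rule: gaps.induct)
  case (2 x)
  then show ?case by (cases ys) auto
qed auto

lemma gaps_Cons: "ys \<noteq> [] \<Longrightarrow> gaps (x # ys) = \<bar>x - hd ys\<bar> # gaps ys"
  by (cases ys) auto

lemma gaps_rev: "gaps (rev xs) = rev (gaps xs)"
proof (induction xs rule: gaps.induct)
  case (3 x y zs)
  have "gaps (rev (x # y # zs)) = gaps (rev (y # zs) @ [x])" by simp
  also have "\<dots> = gaps (rev (y # zs)) @ [\<bar>y - x\<bar>]"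
    by (subst gaps_append) auto
  finally show ?case using 3 by (simp add: abs_minus_commute)
qed auto

lemma gaps_translate: "gaps (map (\<lambda>x. c + x) xs) = gaps xs"
  by (induction xs rule: gaps.induct) auto

lemma gaps_reflect: "gaps (map (\<lambda>x. c - x) xs) = gaps xs"
  by (induction xs rule: gaps.induct) (auto simp: abs_minus_commute)

lemma length_gaps: "length (gaps xs) = length xs - 1"
  by (induction xs rule: gaps.induct) auto

lemma mset_map_eq_mset_set:
  "mset H = mset_set A \<Longrightarrow> inj_on f A \<Longrightarrow> f ` A = B \<Longrightarrow> mset (map f H) = mset_set B"
  by (simp add: image_mset_mset_set)

lemma mset_set_int_split:
  fixes a b c :: int
  assumes "a \<le> b" "b \<le> c"
  shows "mset_set {a..<c} = mset_set {a..<b} + mset_set {b..<c}"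
proof -
  have "{a..<c} = {a..<b} \<union> {b..<c}" using assms by auto
  then show ?thesis by (metis finite_atLeastLessThan_int ivl_disj_int_two(3) mset_set_Union)
qed

lemma mset_set_int_single: "mset_set {a..<a + 1 :: int} = {#a#}"
proof -
  have "{a..<a + 1} = {a}" by auto
  then show ?thesis by simp
qed

lemma reflect_ivl_image: "(\<lambda>x. c - x) ` {a..<b :: int} = {c - b + 1..<c - a + 1}"
proof (intro set_eqI iffI)
  fix y assume "y \<in> {c - b + 1..<c - a + 1}"
  then have "c - y \<in> {a..<b}" "y = c - (c - y)" by auto
  then show "y \<in> (\<lambda>x. c - x) ` {a..<b}" by (rule rev_image_eqI)
qed auto

lemma mset_map_reflect:
  "mset H = mset_set {a..<b} \<Longrightarrow> mset (map (\<lambda>x. c - x) H) = mset_set {c - b + 1..<c - a + 1 :: int}"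
  by (erule mset_map_eq_mset_set) (auto simp: reflect_ivl_image intro: inj_onI)

lemma mset_map_translate:
  "mset H = mset_set {a..<b} \<Longrightarrow> mset (map (\<lambda>x. c + x) H) = mset_set {c + a..<c + b :: int}"
  by (erule mset_map_eq_mset_set) (auto intro: inj_onI)

section \<open>Zigzags\<close>

lemma hd_zigzag: "s > 0 \<Longrightarrow> hd (zigzag a b s) = a"
  by (cases s) auto

lemma zigzag_eq_Nil_iff: "zigzag a b s = [] \<longleftrightarrow> s = 0"
  by (cases s) auto

lemma last_zigzag: "s > 0 \<Longrightarrow> last (zigzag a b s) = b + int s - 1"
proof (induction s arbitrary: a b)
  case (Suc s)
  then show ?case by (cases "s = 0") (auto simp: zigzag_eq_Nil_iff)
qed simp

lemma mset_zigzag: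
  "mset (zigzag a b s) = mset_set {a - int s + 1..<a + 1} + mset_set {b..<b + int s}"
proof (induction s arbitrary: a b)
  case (Suc s)
  have "mset_set {a - int (Suc s) + 1..<a + 1} = mset_set {a - int s..<a} + {#a#}"
    using mset_set_int_split[of "a - int s" a "a + 1"] mset_set_int_single[of a] by simp
  moreover have "mset_set {b..<b + int (Suc s)} = {#b#} + mset_set {b + 1..<b + 1 + int s}"
    using mset_set_int_split[of b "b + 1" "b + 1 + int s"] mset_set_int_single[of b]
    by (simp add: algebra_simps)
  ultimately show ?case using Suc.IH[of "a - 1" "b + 1"] by simp
qed simp

text \<open>Each step moves one end outward by one, so the gaps run upwards from
  \<open>b - a\<close>; \<open>2 * s\<close> vertices give \<open>2 * s - 1\<close> of them.\<close>

lemma mset_gaps_zigzag: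
  assumes "a < b" "s > 0"
  shows "mset (gaps (zigzag a b s)) = mset_set {b - a..<b - a + 2 * int s - 1}"
  using assms
proof (induction s arbitrary: a b)
  case (Suc s)
  show ?case
  proof (cases "s = 0")
    case True
    then show ?thesis using Suc.prems mset_set_int_single[of "b - a"] by (simp add: algebra_simps)
  next
    case False
    then have "gaps (zigzag a b (Suc s)) = (b - a) # (b - a + 1) # gaps (zigzag (a - 1) (b + 1) s)"
      using Suc.prems by (simp add: gaps_Cons hd_zigzag zigzag_eq_Nil_iff)
    moreover have "mset_set {b - a..<b - a + 2 * int (Suc s) - 1}
        = {#b - a#} + {#b - a + 1#} + mset_set {b - a + 2..<b - a + 2 * int s + 1}"
      using mset_set_int_split[of "b - a" "b - a + 1" "b - a + 2 * int s + 1"]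
        mset_set_int_split[of "b - a + 1" "b - a + 1 + 1" "b - a + 2 * int s + 1"]
        mset_set_int_single[of "b - a"] mset_set_int_single[of "b - a + 1"] False
      by (simp add: algebra_simps)
    ultimately show ?thesis
      using Suc.IH[of "a - 1" "b + 1"] Suc.prems False by (simp add: algebra_simps)
  qed
qed simp

lemma alternating_append:
  "alternating p (xs @ ys) \<longleftrightarrow> alternating p xs \<and> alternating p ys \<and>
     (xs = [] \<or> ys = [] \<or> (last xs < p \<longleftrightarrow> \<not> hd ys < p))"
  by (auto simp: alternating_def successively_append_iff)

lemma alternating_zigzag:
  assumes "a < p" "p \<le> b"
  shows "alternating p (zigzag a b s)"
  using assms
proof (induction s arbitrary: a b)
  case 0
  then show ?case by (simp add: alternating_def)
next
  case (Suc s)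
  then have "alternating p (zigzag (a - 1) (b + 1) s)" by simp
  with Suc.prems show ?case
    by (cases s) (auto simp: alternating_def)
qed

section \<open>Graceful paths with prescribed first vertex\<close>

lemma graceful_reflect:
  assumes "graceful n H"
  shows "graceful n (map (\<lambda>x. n - 1 - x) H)"
  using assms mset_map_reflect[of H 0 n "n - 1"] by (simp add: graceful_def gaps_reflect)

lemma set_graceful: "graceful n H \<Longrightarrow> set H = {0..<n}"
  unfolding graceful_def by (metis finite_atLeastLessThan_int finite_set_mset_mset_set set_mset_mset)

text \<open>Every edge joins some \<open>x < p\<close> to some \<open>y \<ge> p\<close>, and the
  images differ by \<open>n - (y - x)\<close>, which is positive since both vertices lie in
  \<open>{0..<n}\<close>.\<close>

lemma gaps_block_reverse:
  assumes "alternating p H" "set H \<subseteq> {0..<n}"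
  shows "gaps (map (\<lambda>x. if x < p then p - 1 - x else n + p - 1 - x) H) = map (\<lambda>d. n - d) (gaps H)"
  using assms by (induction H rule: gaps.induct) (auto simp: alternating_def)

text \<open>The map is an involution preserving both blocks, and sending \<open>d\<close> to
  \<open>n - d\<close> permutes \<open>{1..<n}\<close>.\<close>

lemma graceful_block_reverse:
  assumes H: "graceful n H" "alternating p H" and p: "0 \<le> p" "p \<le> n"
  defines "f \<equiv> \<lambda>x. if x < p then p - 1 - x else n + p - 1 - x"
  shows "graceful n (map f H)" "alternating p (map f H)"
proof -
  have ff: "f (f x) = x" "f x \<in> {0..<n}" "f x < p \<longleftrightarrow> x < p" if "x \<in> {0..<n}" for x
    using that p by (auto simp: f_def)
  have "f ` {0..<n} = {0..<n}"
  proof (intro set_eqI iffI)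
    fix y assume "y \<in> {0..<n}"
    then show "y \<in> f ` {0..<n}" using ff[of y] by (intro rev_image_eqI[of "f y"]) auto
  qed (use ff in blast)
  moreover have "inj_on f {0..<n}" by (rule inj_on_inverseI) (rule ff(1))
  ultimately have "mset (map f H) = mset_set {0..<n}"
    using H by (intro mset_map_eq_mset_set) (auto simp: graceful_def)
  moreover have "gaps (map f H) = map (\<lambda>d. n - d) (gaps H)"
    unfolding f_def using H by (intro gaps_block_reverse) (auto simp: set_graceful)
  then have "mset (gaps (map f H)) = mset_set {1..<n}"
    using mset_map_reflect[of "gaps H" 1 n n] H by (simp add: graceful_def)
  ultimately show "graceful n (map f H)" by (simp add: graceful_def)
  have "successively (\<lambda>x y. f x < p \<longleftrightarrow> \<not> f y < p) H"
    by (rule successively_mono[OF H(2)[unfolded alternating_def]]) (use ff(3) set_graceful[OF H(1)] in auto)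
  then show "alternating p (map f H)" by (simp add: alternating_def successively_map)
qed

section \<open>Extension by an outer zigzag\<close>

text \<open>The zigzag takes \<open>k + 1\<close> vertices at each end and the differences above
  \<open>n'\<close>. It stops at \<open>n - 1\<close> and the shifted inner path starts at
  \<open>2 * k + 1\<close>, so the joining edge supplies \<open>n'\<close>.\<close>

lemma graceful_even_extend:
  fixes k :: nat
  assumes H: "graceful n' H" "H \<noteq> []" "hd H = int k"
    and n: "n = n' + 2 * int k + 2"
  shows "graceful n (zigzag (int k) (n - 1 - int k) (k + 1) @ map (\<lambda>x. int k + 1 + x) H)"
    (is "graceful n (?Z @ ?H)")
proof -
  have "int k < n'" using H set_graceful[OF H(1)] hd_in_set[OF H(2)] by auto
  then have pos: "n' > 0" by simp
  have mH: "mset ?H = mset_set {int k + 1..<int k + 1 + n'}"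
    using mset_map_translate[of H 0 n' "int k + 1"] H by (simp add: graceful_def)
  have mZ: "mset ?Z = mset_set {0..<int k + 1} + mset_set {int k + 1 + n'..<n}"
    unfolding mset_zigzag using n by (simp add: algebra_simps)
  have "mset (?Z @ ?H) = mset_set {0..<n}"
    unfolding mset_append mH mZ
    using mset_set_int_split[of 0 "int k + 1" n] mset_set_int_split[of "int k + 1" "int k + 1 + n'" n] n pos
    by simp
  moreover have "gaps (?Z @ ?H) = gaps ?Z @ n' # gaps H"
    using H n pos by (subst gaps_append) (auto simp: zigzag_eq_Nil_iff last_zigzag gaps_translate hd_map simp del: zigzag.simps)
  moreover have "mset (gaps ?Z) = mset_set {n' + 1..<n}"
    using n pos by (subst mset_gaps_zigzag) (auto simp: algebra_simps)
  moreover have "mset (gaps H) = mset_set {1..<n'}" using H by (simp add: graceful_def)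
  ultimately show ?thesis
    using mset_set_int_split[of 1 n' n] mset_set_int_split[of n' "n' + 1" n] mset_set_int_single[of n'] n pos
    unfolding graceful_def by simp
qed

lemma alternating_translate: "alternating p (map (\<lambda>x. c + x) H) \<longleftrightarrow> alternating (p - c) H"
  by (simp add: alternating_def successively_map algebra_simps)

lemma alternating_reflect: "alternating p (map (\<lambda>x. c - x) H) \<longleftrightarrow> alternating (c - p + 1) H"
proof -
  have "(c - x < p \<longleftrightarrow> \<not> c - y < p) \<longleftrightarrow> (x < c - p + 1 \<longleftrightarrow> \<not> y < c - p + 1)" for x y :: int
    by auto
  then show ?thesis by (simp add: alternating_def successively_map)
qed

text \<open>The odd-length variant \<open>k, n - k, k - 1, ..., n - 1, 0\<close> stops on the low
  side, with \<open>k + 1\<close> vertices from the bottom and \<open>k\<close> from the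
  top.\<close>

definition odd_zigzag :: "nat \<Rightarrow> int \<Rightarrow> int list" where
  "odd_zigzag k n = zigzag (int k) (n - int k) k @ [0]"

lemma odd_zigzag_nonempty: "odd_zigzag k n \<noteq> []"
  by (simp add: odd_zigzag_def)

lemma hd_odd_zigzag: "hd (odd_zigzag k n) = int k"
  by (cases k) (auto simp: odd_zigzag_def)

lemma mset_odd_zigzag:
  "mset (odd_zigzag k n) = mset_set {0..<int k + 1} + mset_set {n - int k..<n}"
  using mset_set_int_split[of 0 1 "int k + 1"] mset_set_int_single[of 0]
  by (simp add: odd_zigzag_def mset_zigzag)

lemma mset_gaps_odd_zigzag:
  assumes "2 * int k < n"
  shows "mset (gaps (odd_zigzag k n)) = mset_set {n - 2 * int k..<n}"
proof (cases "k = 0")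
  case False
  then have "mset (gaps (odd_zigzag k n)) = mset_set {n - 2 * int k..<n - 1} + {#n - 1#}"
    using assms by (simp add: odd_zigzag_def gaps_append zigzag_eq_Nil_iff last_zigzag mset_gaps_zigzag)
  then show ?thesis
    using mset_set_int_split[of "n - 2 * int k" "n - 1" n] mset_set_int_single[of "n - 1"] False by simp
qed (simp add: odd_zigzag_def)

lemma alternating_odd_zigzag:
  assumes "int k < p" "p \<le> n - int k"
  shows "alternating p (odd_zigzag k n)"
  using assms unfolding odd_zigzag_def alternating_append
  by (auto simp: alternating_zigzag zigzag_eq_Nil_iff last_zigzag) (auto simp: alternating_def)

lemma graceful_odd_zigzag: "graceful (2 * int k + 1) (odd_zigzag k (2 * int k + 1))"
  using mset_odd_zigzag[of k "2 * int k + 1"] mset_gaps_odd_zigzag[of k "2 * int k + 1"]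
    mset_set_int_split[of 0 "int k + 1" "2 * int k + 1"]
  by (simp add: graceful_def)

text \<open>The zigzag now stops at \<open>0\<close>; reflecting the inner path puts its first
  vertex at \<open>n - 1 - 2 * k = n'\<close>, so the joining edge again supplies
  \<open>n'\<close>.\<close>

lemma graceful_odd_extend:
  fixes k :: nat
  assumes H: "graceful n' H" "H \<noteq> []" "hd H = int k"
    and n: "n = n' + 2 * int k + 1"
  shows "graceful n (odd_zigzag k n @ map (\<lambda>x. n - 1 - int k - x) H)"
    (is "graceful n (?Z @ ?H)")
proof -
  have "int k < n'" using H set_graceful[OF H(1)] hd_in_set[OF H(2)] by auto
  then have pos: "n' > 0" by simp
  have mH: "mset ?H = mset_set {int k + 1..<int k + 1 + n'}"
    using mset_map_reflect[of H 0 n' "n - 1 - int k"] H n by (simp add: graceful_def algebra_simps)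
  have mZ: "mset ?Z = mset_set {0..<int k + 1} + mset_set {int k + 1 + n'..<n}"
    using n by (simp add: mset_odd_zigzag algebra_simps)
  have "mset (?Z @ ?H) = mset_set {0..<n}"
    unfolding mset_append mH mZ
    using mset_set_int_split[of 0 "int k + 1" n] mset_set_int_split[of "int k + 1" "int k + 1 + n'" n] n pos
    by simp
  moreover have "gaps (?Z @ ?H) = gaps ?Z @ n' # gaps H"
    using H n pos by (subst gaps_append) (auto simp: odd_zigzag_def gaps_reflect hd_map)
  moreover have "mset (gaps ?Z) = mset_set {n' + 1..<n}"
    using n pos by (subst mset_gaps_odd_zigzag) (auto simp: algebra_simps)
  moreover have "mset (gaps H) = mset_set {1..<n'}" using H by (simp add: graceful_def)
  ultimately show ?thesis
    using mset_set_int_split[of 1 n' n] mset_set_int_split[of n' "n' + 1" n] mset_set_int_single[of n'] n pos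
    unfolding graceful_def by simp
qed

text \<open>Reflection exchanges low and high. As \<open>k < p'\<close>, the inner path starts low,
  hence high after reflection, and the joining edge from \<open>0\<close> crosses the threshold
  too.\<close>

lemma alternating_odd_extend:
  fixes k :: nat
  assumes H: "alternating p' H" "H \<noteq> []" "hd H = int k" and k: "int k < p'" "p' \<le> n'"
    and n: "n = n' + 2 * int k + 1"
  shows "alternating (n - int k - p') (odd_zigzag k n @ map (\<lambda>x. n - 1 - int k - x) H)"
  using assms unfolding alternating_append alternating_reflect
  by (auto simp: alternating_odd_zigzag hd_map) (auto simp: odd_zigzag_def)

section \<open>Existence for every first vertex\<close>

lemma ex_alternating_graceful_even:
  assumes "k < p"
  shows "\<exists>H. graceful (2 * int p) H \<and> alternating (int p) H \<and> H \<noteq> [] \<and> hd H = int k"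
  using assms
proof (induction p arbitrary: k rule: less_induct)
  case (less p)
  have small: "\<exists>H. graceful (2 * int p) H \<and> alternating (int p) H \<and> H \<noteq> [] \<and> hd H = int k"
    if "2 * k + 1 < p" for k
  proof -
    \<comment> \<open>The zigzag leaves \<open>2 * p - (2 * k + 2) = 2 * j\<close> vertices, and
      \<open>2 * k + 1 < p\<close> says exactly that \<open>k < j\<close>.\<close>
    define j where "j = p - 1 - k"
    have j: "int p = int j + int k + 1" "k < j" "j < p" using that by (auto simp: j_def)
    obtain H where H: "graceful (2 * int j) H" "alternating (int j) H" "H \<noteq> []" "hd H = int k"
      using less.IH[OF j(3,2)] by auto
    let ?H = "zigzag (int k) (2 * int p - 1 - int k) (k + 1) @ map (\<lambda>x. int k + 1 + x) H"
    have "graceful (2 * int p) ?H"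
      using H j(1) by (intro graceful_even_extend) auto
    moreover have "alternating (int p) (zigzag (int k) (2 * int p - 1 - int k) (k + 1))"
      using that by (intro alternating_zigzag) auto
    moreover have "alternating (int p) (map (\<lambda>x. int k + 1 + x) H)"
      using H(2) j(1) by (simp add: alternating_translate)
    ultimately show ?thesis
      using H that
      by (intro exI[of _ ?H])
        (auto simp: alternating_append last_zigzag hd_zigzag hd_map hd_append zigzag_eq_Nil_iff
          simp del: zigzag.simps)
  qed
  consider "2 * k + 1 < p" | "2 * k + 1 > p" | "p = 2 * k + 1" by linarith
  then show ?case
  proof cases
    case 1
    then show ?thesis by (rule small)
  next
    case 2
    \<comment> \<open>Block reversal at \<open>p\<close> exchanges the first vertices
      \<open>j\<close> and \<open>k\<close>, and \<open>j\<close> is small.\<close>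
    define j where "j = p - 1 - k"
    have j: "int p = int j + int k + 1" "2 * j + 1 < p" using 2 less.prems by (auto simp: j_def)
    obtain H where H: "graceful (2 * int p) H" "alternating (int p) H" "H \<noteq> []" "hd H = int j"
      using small[OF j(2)] by auto
    let ?f = "\<lambda>x. if x < int p then int p - 1 - x else 2 * int p + int p - 1 - x"
    have "graceful (2 * int p) (map ?f H)" "alternating (int p) (map ?f H)"
      by (rule graceful_block_reverse[OF H(1,2)]; simp)+
    moreover have "hd (map ?f H) = int k" using H(3,4) j(1) by (simp add: hd_map)
    ultimately show ?thesis using H(3) by blast
  next
    case 3
    \<comment> \<open>Here block reversal fixes \<open>k\<close>. An odd zigzag leaves
      \<open>2 * k + 1\<close> vertices, and a zigzag from their centre \<open>k\<close> fills
      them.\<close>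
    let ?C = "odd_zigzag k (2 * int k + 1)"
    let ?H = "odd_zigzag k (2 * int p) @ map (\<lambda>x. 2 * int p - 1 - int k - x) ?C"
    have C: "?C \<noteq> []" "hd ?C = int k" by (simp_all add: hd_odd_zigzag odd_zigzag_nonempty)
    have "graceful (2 * int p) ?H"
      by (rule graceful_odd_extend[OF graceful_odd_zigzag]) (use 3 C in auto)
    moreover have "alternating (2 * int p - int k - (int k + 1)) ?H"
      by (rule alternating_odd_extend[OF alternating_odd_zigzag]) (use 3 C in auto)
    moreover have "2 * int p - int k - (int k + 1) = int p" using 3 by simp
    moreover have "?H \<noteq> []" "hd ?H = int k" by (simp_all add: hd_odd_zigzag odd_zigzag_nonempty)
    ultimately show ?thesis by metis
  qed
qed

lemma ex_graceful_hd_reflect: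
  assumes "\<exists>H. graceful (int n) H \<and> H \<noteq> [] \<and> hd H = int j" and n: "n = j + k + 1"
  shows "\<exists>H. graceful (int n) H \<and> H \<noteq> [] \<and> hd H = int k"
proof -
  obtain H where H: "graceful (int n) H" "H \<noteq> []" "hd H = int j"
    using assms(1) by blast
  have "hd (map (\<lambda>x. int n - 1 - x) H) = int k" using H(2,3) n by (simp add: hd_map)
  with graceful_reflect[OF H(1)] H(2) show ?thesis by blast
qed

lemma ex_graceful_even:
  assumes "k < 2 * p"
  shows "\<exists>H. graceful (int (2 * p)) H \<and> H \<noteq> [] \<and> hd H = int k"
proof (cases "k < p")
  case True
  then show ?thesis using ex_alternating_graceful_even[of k p] by auto
next
  case False
  define j where "j = 2 * p - 1 - k"
  have j: "j < p" "2 * p = j + k + 1" using False assms by (auto simp: j_def)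
  have "\<exists>H. graceful (int (2 * p)) H \<and> H \<noteq> [] \<and> hd H = int j"
    using ex_alternating_graceful_even[OF j(1)] by auto
  then show ?thesis using j(2) by (rule ex_graceful_hd_reflect)
qed

text \<open>An odd zigzag leaves the even number \<open>2 * (q - k)\<close> of vertices, where any
  first vertex is available; this covers \<open>k < 2 * (q - k)\<close>. Larger \<open>k < q\<close>
  come from \<open>q - k\<close> by block reversal, and \<open>k = q\<close> is the centre.\<close>

lemma ex_graceful_odd:
  assumes "k \<le> q"
  shows "\<exists>H. graceful (int (2 * q + 1)) H \<and> H \<noteq> [] \<and> hd H = int k"
proof -
  let ?n = "int (2 * q + 1)"
  consider "q = k" | "3 * k < 2 * q" | "k < q" "2 * q \<le> 3 * k" using assms by linarith
  then show ?thesis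
  proof cases
    case 1
    with graceful_odd_zigzag[of k] show ?thesis
      by (intro exI[of _ "odd_zigzag k (2 * int k + 1)"])
        (auto simp: hd_odd_zigzag odd_zigzag_nonempty algebra_simps)
  next
    case 2
    define j where "j = q - k"
    have j: "q = j + k" "k < 2 * j" using 2 by (auto simp: j_def)
    obtain H where H: "graceful (int (2 * j)) H" "H \<noteq> []" "hd H = int k"
      using ex_graceful_even[OF j(2)] by blast
    have "graceful ?n (odd_zigzag k ?n @ map (\<lambda>x. ?n - 1 - int k - x) H)"
      by (rule graceful_odd_extend[OF H]) (use j in simp)
    then show ?thesis
      by (metis append_is_Nil_conv hd_append2 hd_odd_zigzag odd_zigzag_nonempty)
  next
    case 3
    define j where "j = q - k"
    have j: "q = j + k" "j < k" using 3 by (auto simp: j_def)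
    obtain H where H: "graceful (2 * int k) H" "alternating (int k) H" "H \<noteq> []" "hd H = int j"
      using ex_alternating_graceful_even[OF j(2)] by auto
    \<comment> \<open>The zigzag from \<open>j\<close> leaves \<open>2 * k\<close> vertices. The
      threshold becomes \<open>?n - j - k = q + 1\<close>, and reversal there sends \<open>j\<close>
      to \<open>q - j = k\<close>.\<close>
    define G where "G = odd_zigzag j ?n @ map (\<lambda>x. ?n - 1 - int j - x) H"
    have G: "graceful ?n G" unfolding G_def
      by (rule graceful_odd_extend[OF H(1,3,4)]) (use j in simp)
    have "alternating (?n - int j - int k) G" unfolding G_def
      by (rule alternating_odd_extend[OF H(2,3,4)]) (use j in auto)
    then have alt: "alternating (int q + 1) G" using j by (simp add: algebra_simps)
    let ?f = "\<lambda>x. if x < int q + 1 then int q + 1 - 1 - x else ?n + (int q + 1) - 1 - x"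
    have "graceful ?n (map ?f G)"
      by (rule graceful_block_reverse[OF G alt]) auto
    moreover have "hd G = int j" "G \<noteq> []" by (simp_all add: G_def hd_odd_zigzag odd_zigzag_nonempty)
    then have "hd (map ?f G) = int k" "map ?f G \<noteq> []" using j(1) by (simp_all add: hd_map)
    ultimately show ?thesis by blast
  qed
qed

lemma ex_graceful_hd:
  assumes "k < n"
  shows "\<exists>H. graceful (int n) H \<and> H \<noteq> [] \<and> hd H = int k"
proof (cases "even n")
  case True
  then obtain p where "n = 2 * p" by (elim evenE)
  then show ?thesis using ex_graceful_even assms by blast
next
  case False
  then obtain q where q: "n = 2 * q + 1" by (elim oddE)
  show ?thesis
  proof (cases "k \<le> q")
    case True
    then show ?thesis using ex_graceful_odd q by blast
  next
    case False
    define j where "j = n - 1 - k"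
    have j: "j \<le> q" "n = j + k + 1" using False assms q by (auto simp: j_def)
    show ?thesis using ex_graceful_odd[OF j(1)] j(2) unfolding q by (rule ex_graceful_hd_reflect)
  qed
qed

section \<open>Hamiltonian paths and edge lengths\<close>

lemma gaps_bounds:
  assumes "set H \<subseteq> {0..<n}" "g \<in> set (gaps H)"
  shows "0 \<le> g \<and> g < n"
  using assms by (induction H rule: gaps.induct) auto

lemma edge_lengths_eq_gaps:
  "edge_lengths v H = image_mset (\<lambda>g. nat (min g (int v - g))) (mset (gaps (map int H)))"
proof -
  have "map2 (edge_length v) (butlast (x # H)) H
      = map (\<lambda>g. nat (min g (int v - g))) (gaps (map int (x # H)))" for x
  proof (induction H arbitrary: x)
    case (Cons y H)
    have "edge_length v x y = nat (min \<bar>int x - int y\<bar> (int v - \<bar>int x - int y\<bar>))"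
      by (simp add: edge_length_def nat_diff_distrib' monoI nat_mono flip: min_of_mono[of nat])
    with Cons.IH[of y] show ?case by simp
  qed simp
  then show ?thesis by (cases H) (simp_all add: edge_lengths_def flip: mset_map)
qed

section \<open>Necessity of the divisor condition\<close>

text \<open>Only an edge whose difference is not divisible by \<open>d\<close> can enter a new
  residue class, and it enters at most one.\<close>

lemma card_residues_le:
  assumes "H \<noteq> []"
  shows "card ((\<lambda>x. x mod d) ` set H) \<le> 1 + length (filter (\<lambda>g. \<not> d dvd g) (gaps H))"
  using assms
proof (induction H rule: gaps.induct)
  case (3 x y zs)
  let ?R = "(\<lambda>x. x mod d) ` set (y # zs)"
  have IH: "card ?R \<le> 1 + length (filter (\<lambda>g. \<not> d dvd g) (gaps (y # zs)))" using 3 by simp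
  have eq: "(\<lambda>x. x mod d) ` set (x # y # zs) = insert (x mod d) ?R" by simp
  show ?case
  proof (cases "d dvd x - y")
    case True
    then have "x mod d = y mod d" by (simp add: mod_eq_dvd_iff)
    then have "(\<lambda>x. x mod d) ` set (x # y # zs) = ?R" by simp
    then show ?thesis using IH True by simp
  next
    case False
    have "card ((\<lambda>x. x mod d) ` set (x # y # zs)) \<le> Suc (card ?R)"
      unfolding eq by (rule card_insert_le_m1[THEN order_trans]) auto
    then show ?thesis using IH False by simp
  qed
qed auto

lemma hamiltonian_path_divisor_bound:
  assumes H: "hamiltonian_path v H" and d: "d dvd v" and v: "v > 0"
  shows "size (filter_mset (\<lambda>l. d dvd l) (edge_lengths v H)) \<le> v - d"
proof -
  let ?G = "map int H"
  have setH: "set H = {0..<v}" and "distinct H" using H by (auto simp: hamiltonian_path_def)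
  then have len: "length H = v" using distinct_card by fastforce
  then have ne: "?G \<noteq> []" using v by auto
  have dv: "d \<le> v" "d > 0" using d v by (auto simp: dvd_imp_le intro: Nat.gr0I)
  have setG: "set ?G = {0..<int v}" using setH by (simp add: image_int_atLeastLessThan)
  \<comment> \<open>As \<open>d\<close> divides \<open>v\<close>, folding \<open>g\<close> to
    \<open>v - g\<close> preserves divisibility, so gaps can be counted instead of lengths.\<close>
  have "d dvd nat (min g (int v - g)) \<longleftrightarrow> int d dvd g" if "g \<in> set (gaps ?G)" for g
  proof -
    have g: "0 \<le> g" "g < int v" using gaps_bounds[OF _ that, of "int v"] setG by auto
    have "int d dvd int v - g \<longleftrightarrow> int d dvd g"
      using d by (simp add: dvd_diff_right_iff)
    then show ?thesis using g by (auto simp: nat_dvd_iff min_def simp flip: int_dvd_int_iff)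
  qed
  then have eq: "size (filter_mset (\<lambda>l. d dvd l) (edge_lengths v H))
      = length (filter (\<lambda>g. int d dvd g) (gaps ?G))"
    unfolding edge_lengths_eq_gaps
    by (simp add: filter_mset_image_mset flip: mset_filter) (metis (mono_tags, lifting) filter_cong)
  have "{0..<int d} \<subseteq> (\<lambda>x. x mod int d) ` set ?G"
  proof
    fix x assume "x \<in> {0..<int d}"
    then have "x \<in> set ?G" "x = x mod int d" unfolding setG using dv by auto
    then show "x \<in> (\<lambda>x. x mod int d) ` set ?G" by (rule rev_image_eqI)
  qed
  then have "card {0..<int d} \<le> card ((\<lambda>x. x mod int d) ` set ?G)"
    by (intro card_mono) auto
  also have "\<dots> \<le> 1 + length (filter (\<lambda>g. \<not> int d dvd g) (gaps ?G))"
    by (rule card_residues_le[OF ne])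
  finally have "d \<le> 1 + length (filter (\<lambda>g. \<not> int d dvd g) (gaps ?G))" by simp
  moreover have "length (filter (\<lambda>g. int d dvd g) (gaps ?G)) + length (filter (\<lambda>g. \<not> int d dvd g) (gaps ?G)) = v - 1"
    using sum_length_filter_compl[of "\<lambda>g. int d dvd g" "gaps ?G"] len by (simp add: length_gaps)
  ultimately show ?thesis using eq v by linarith
qed

text \<open>The realization makes one side of the equivalence true, and the divisor bound then makes
  the other true.\<close>

lemma BHR_if_realized:
  assumes "v > 0" "\<exists>H. hamiltonian_path v H \<and> edge_lengths v H = L"
  shows "BHR v L"
  using assms hamiltonian_path_divisor_bound unfolding BHR_def by blast

section \<open>Realization of the lists\<close>

lemma nat_image_int_ivl: "nat ` {int a..<int b} = {a..<b}"
  by (simp add: image_image flip: image_int_atLeastLessThan)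

lemma hamiltonian_path_map_nat:
  assumes "mset G = mset_set {0..<int v}"
  shows "hamiltonian_path v (map nat G)"
    and "edge_lengths v (map nat G) = image_mset (\<lambda>g. nat (min g (int v - g))) (mset (gaps G))"
proof -
  have setG: "set G = {0..<int v}"
    using assms by (metis finite_atLeastLessThan_int finite_set_mset_mset_set set_mset_mset)
  have "map int (map nat G) = G" using setG by (auto intro!: map_idI)
  then show "edge_lengths v (map nat G) = image_mset (\<lambda>g. nat (min g (int v - g))) (mset (gaps G))"
    unfolding edge_lengths_eq_gaps by simp
  have "distinct G"
    unfolding distinct_count_atmost_1 using assms setG by (auto simp: count_mset_set')
  then have dist: "distinct (map nat G)"
    unfolding distinct_map using setG by (auto simp: inj_on_def)
  have set_nat: "set (map nat G) = {0..<v}"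
    using setG nat_image_int_ivl[of 0 v] by simp
  from dist have "successively (\<noteq>) (map nat G)"
    by (simp add: successively_conv_nth nth_eq_iff_index_eq del: length_map nth_map)
  then have "successively (\<lambda>x y. {x, y} \<in> complete_graph_edges v) (map nat G)"
    by (rule successively_mono) (use set_nat in \<open>auto simp: complete_graph_edges_def\<close>)
  with dist set_nat show "hamiltonian_path v (map nat G)" by (simp add: hamiltonian_path_def)
qed

text \<open>Differences within \<open>n \<le> v / 2\<close> consecutive vertices are below
  \<open>v / 2\<close>, so none of them is folded.\<close>

lemma image_gaps_graceful:
  assumes "graceful (int n) H" "2 * n \<le> v"
  shows "image_mset (\<lambda>g. nat (min g (int v - g))) (mset (gaps H)) = mset_set {1..<n}"
proof -
  have "image_mset (\<lambda>g. nat (min g (int v - g))) (mset (gaps H)) = image_mset nat (mset_set {1..<int n})"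
    using assms by (auto simp: graceful_def intro!: image_mset_cong)
  also have "\<dots> = mset_set (nat ` {1..<int n})"
    by (rule image_mset_mset_set) (auto simp: inj_on_def)
  also have "nat ` {1..<int n} = {1..<n}"
    using nat_image_int_ivl[of 1 n] by simp
  finally show ?thesis .
qed

lemma sum_replicate_mset_2: "(\<Sum>i\<in>A. replicate_mset 2 i) = mset_set A + mset_set A"
  by (simp add: numeral_2_eq_2 sum.distrib[of "\<lambda>i. {#i#}" "\<lambda>i. {#i#}", simplified])

text \<open>What remains is what two graceful paths on \<open>m\<close> vertices contribute.\<close>

lemma Lstar_odd_minus:
  assumes "1 \<le> m"
  shows "Lstar (2 * m + 1) - {#m, m#} = mset_set {1..<m} + mset_set {1..<m}"
proof -
  have "{1..m} = insert m {1..<m}" using assms by auto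
  then show ?thesis by (simp add: Lstar_def sum_replicate_mset_2)
qed

lemma Lstar_even_minus:
  assumes "2 \<le> m"
  shows "Lstar (2 * m) - {#m - 1, m - 1#} = mset_set {1..<m - 1} + mset_set {1..<m - 1} + {#m#}"
proof -
  have "{1..<m} = insert (m - 1) {1..<m - 1}" using assms by auto
  then show ?thesis by (simp add: Lstar_def sum_replicate_mset_2)
qed

lemma ex_path_odd:
  assumes "1 \<le> z1" "z1 < m" "1 \<le> z2" "z2 < m"
  shows "\<exists>H. hamiltonian_path (2 * m + 1) H \<and>
    edge_lengths (2 * m + 1) H = mset_set {1..<m} + mset_set {1..<m} + {#z1, z2#}"
proof -
  obtain A where A: "graceful (int m) A" "A \<noteq> []" "hd A = int (z1 - 1)"
    using ex_graceful_hd[OF less_imp_diff_less, of z1 m 1] assms by blast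
  obtain C where C: "graceful (int m) C" "C \<noteq> []" "hd C = int (z2 - 1)"
    using ex_graceful_hd[OF less_imp_diff_less, of z2 m 1] assms by blast
  let ?C = "map (\<lambda>x. 2 * int m - 1 - x) C"
  let ?G = "rev A @ 2 * int m # ?C"
  have mC: "mset ?C = mset_set {int m..<2 * int m}"
    using mset_map_reflect[of C 0 "int m" "2 * int m - 1"] C(1) by (simp add: graceful_def)
  have "mset (rev A) = mset_set {0..<int m}" using A(1) by (simp add: graceful_def)
  then have mG: "mset ?G = mset_set {0..<int (2 * m + 1)}"
    unfolding mset_append mset.simps mC
    using mset_set_int_split[of 0 "int m" "2 * int m + 1"]
      mset_set_int_split[of "int m" "2 * int m" "2 * int m + 1"] mset_set_int_single[of "2 * int m"]
    by (simp add: algebra_simps)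
  \<comment> \<open>The first joining difference exceeds half of \<open>2 * m + 1\<close> and folds
    to the length \<open>z1\<close>.\<close>
  have "gaps ?G = rev (gaps A) @ (2 * int m + 1 - int z1) # int z2 # gaps C"
    using A C assms
    by (simp add: gaps_append gaps_rev gaps_Cons gaps_reflect last_rev hd_map of_nat_diff)
  then have "edge_lengths (2 * m + 1) (map nat ?G) = mset_set {1..<m} + mset_set {1..<m} + {#z1, z2#}"
    unfolding hamiltonian_path_map_nat(2)[OF mG]
    using image_gaps_graceful[OF A(1), of "2 * m + 1"] image_gaps_graceful[OF C(1), of "2 * m + 1"] assms
    by (simp add: min_def)
  with hamiltonian_path_map_nat(1)[OF mG] show ?thesis by blast
qed

lemma ex_path_even:
  assumes "1 \<le> z1" "z1 < m - 1" "1 \<le> z2" "z2 < m - 1"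
  shows "\<exists>H. hamiltonian_path (2 * m) H \<and>
    edge_lengths (2 * m) H = mset_set {1..<m - 1} + mset_set {1..<m - 1} + {#m#} + {#z1, z2#}"
proof -
  define n where "n = m - 1"
  have m: "m = n + 1" using assms by (simp add: n_def)
  have z: "1 \<le> z1" "z1 < n" "1 \<le> z2" "z2 < n" using assms by (auto simp: n_def)
  obtain A where A: "graceful (int n) A" "A \<noteq> []" "hd A = int (z1 - 1)"
    using ex_graceful_hd[OF less_imp_diff_less, of z1 n 1] z by blast
  obtain C where C: "graceful (int n) C" "C \<noteq> []" "hd C = int (z2 - 1)"
    using ex_graceful_hd[OF less_imp_diff_less, of z2 n 1] z by blast
  let ?C = "map (\<lambda>x. int m + x) C"
  \<comment> \<open>The connectors are the antipodal vertices \<open>2 * m - 1\<close> and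
    \<open>m - 1\<close>, whose edge gives the single \<open>m\<close>; the difference
    \<open>2 * m - z1\<close> before them folds to \<open>z1\<close>.\<close>
  let ?G = "rev A @ (2 * int n + 1) # int n # ?C"
  have mC: "mset ?C = mset_set {int n + 1..<2 * int n + 1}"
    using mset_map_translate[of C 0 "int n" "int m"] C(1) m by (simp add: graceful_def algebra_simps)
  have "mset (rev A) = mset_set {0..<int n}" using A(1) by (simp add: graceful_def)
  then have mG: "mset ?G = mset_set {0..<int (2 * m)}"
    unfolding mset_append mset.simps mC
    using mset_set_int_split[of 0 "int n" "2 * int n + 1 + 1"]
      mset_set_int_split[of "int n" "int n + 1" "2 * int n + 1 + 1"]
      mset_set_int_split[of "int n + 1" "2 * int n + 1" "2 * int n + 1 + 1"]
      mset_set_int_single[of "2 * int n + 1"] mset_set_int_single[of "int n"] m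
    by (simp add: algebra_simps)
  have "gaps ?G = rev (gaps A) @ (2 * int m - int z1) # int m # int z2 # gaps C"
    using A C z m
    by (simp add: gaps_append gaps_rev gaps_Cons gaps_translate last_rev hd_map of_nat_diff)
  then have "edge_lengths (2 * m) (map nat ?G) = mset_set {1..<n} + mset_set {1..<n} + {#m#} + {#z1, z2#}"
    unfolding hamiltonian_path_map_nat(2)[OF mG]
    using image_gaps_graceful[OF A(1), of "2 * m"] image_gaps_graceful[OF C(1), of "2 * m"] z m
    by (simp add: min_def)
  with hamiltonian_path_map_nat(1)[OF mG] show ?thesis unfolding n_def by blast
qed

theorem theorem6p4:
  "(\<forall>v m z1 z2 :: nat. \<forall>L.
      v = 2 * m + 1 \<and> 1 \<le> z1 \<and> z1 < m \<and> 1 \<le> z2 \<and> z2 < m \<and>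
      L = (Lstar v - {#m, m#}) + {#z1, z2#} \<longrightarrow>
      BHR v L \<and> (\<exists>H. hamiltonian_path v H \<and> edge_lengths v H = L)) \<and>
   (\<forall>v m z1 z2 :: nat. \<forall>L.
      v = 2 * m \<and> 1 \<le> z1 \<and> z1 < m - 1 \<and> 1 \<le> z2 \<and> z2 < m - 1 \<and>
      L = (Lstar v - {#m - 1, m - 1#}) + {#z1, z2#} \<longrightarrow>
      BHR v L \<and> (\<exists>H. hamiltonian_path v H \<and> edge_lengths v H = L))"
proof (intro conjI allI impI; elim conjE)
  fix v m z1 z2 :: nat and L
  assume v: "v = 2 * m + 1" and z: "1 \<le> z1" "z1 < m" "1 \<le> z2" "z2 < m"
    and L: "L = (Lstar v - {#m, m#}) + {#z1, z2#}"
  have "L = mset_set {1..<m} + mset_set {1..<m} + {#z1, z2#}"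
    unfolding L v using z by (subst Lstar_odd_minus) auto
  then show ex: "\<exists>H. hamiltonian_path v H \<and> edge_lengths v H = L"
    using ex_path_odd[OF z] v by simp
  show "BHR v L" by (rule BHR_if_realized[OF _ ex]) (use v in simp)
next
  fix v m z1 z2 :: nat and L
  assume v: "v = 2 * m" and z: "1 \<le> z1" "z1 < m - 1" "1 \<le> z2" "z2 < m - 1"
    and L: "L = (Lstar v - {#m - 1, m - 1#}) + {#z1, z2#}"
  have "L = mset_set {1..<m - 1} + mset_set {1..<m - 1} + {#m#} + {#z1, z2#}"
    unfolding L v using z by (subst Lstar_even_minus) auto
  then show ex: "\<exists>H. hamiltonian_path v H \<and> edge_lengths v H = L"
    using ex_path_even[OF z] v by simp
  show "BHR v L" by (rule BHR_if_realized[OF _ ex]) (use v z in simp)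
qed

end
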